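(* Let $\kappa$ be an infinite cardinal, let $X$ be a real Banach space that is $\mathrm{SQ}_{<\kappa}$ and let $Y\subseteq X$ be a $\kappa$ isometric ideal in $X$. Then $Y$ is $\mathrm{SQ}_{<\kappa}$.
   Context: For a normed space $Z$, $\operatorname{dens}(Z)$ is the least cardinality of a subset of $Z$ whose linear span is dense in $Z$ (so it equals $\dim Z$ if $Z$ is finite dimensional); $S_Z$ is its unit sphere. A subspace $Y$ of a Banach space $X$ is a $\kappa$ isometric ideal in $X$ if for every subspace $E\subseteq X$ with $\operatorname{dens}(E)<\kappa$ there is a linear norm-preserving map $T:E\to Y$ with $T(e)=e$ for all $e\in E\cap Y$. A normed space $X$ is $<\kappa$-square ($\mathrm{SQ}_{<\kappa}$) if for every subspace $Z\subseteq X$ with $\operatorname{dens}(Z)<\kappa$ there is $x\in S_X$ such that $\|z+\lambda x\|\le\max\{\|z\|,|\lambda|\}$ for all $z\in Z$ and $\lambda\in\mathbb R$. *)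

theory Defs
  imports "HOL-Analysis.Analysis"
begin

unbundle cardinal_syntax

definition dense_span_in :: "'a::real_normed_vector set \<Rightarrow> 'a set \<Rightarrow> bool" where
  "dense_span_in A Z \<longleftrightarrow> A \<subseteq> Z \<and> Z \<subseteq> closure (span A)"

text \<open>Cardinals are well-order relations in the sense of the HOL cardinal library, so the
  density is the canonical cardinal \<open>|A|\<close> of a subset \<open>A\<close> of least cardinality; it is
  determined up to \<open>=o\<close>.\<close>

definition dens :: "'a::real_normed_vector set \<Rightarrow> 'a rel" where
  "dens Z = |SOME A. dense_span_in A Z \<and> (\<forall>B. dense_span_in B Z \<longrightarrow> |A| \<le>o |B| )|"

text \<open>Only the values of \<open>T\<close> on \<open>E\<close> matter, so linearity is required on \<open>E\<close> only. Subspaces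
  are linear subspaces, not assumed closed.\<close>

definition isometric_ideal :: "'k rel \<Rightarrow> 'a::banach set \<Rightarrow> bool" where
  "isometric_ideal \<kappa> Y \<longleftrightarrow> subspace Y \<and>
     (\<forall>E. subspace E \<and> dens E <o \<kappa> \<longrightarrow>
       (\<exists>T. T \<in> E \<rightarrow> Y \<and>
            (\<forall>u\<in>E. \<forall>v\<in>E. T (u + v) = T u + T v) \<and>
            (\<forall>c. \<forall>u\<in>E. T (c *\<^sub>R u) = c *\<^sub>R T u) \<and>
            (\<forall>u\<in>E. norm (T u) = norm u) \<and>
            (\<forall>e \<in> E \<inter> Y. T e = e)))"

text \<open>The normed space \<open>X\<close> is a subspace of the ambient type, with the inherited norm.\<close>

definition SQ_less :: "'k rel \<Rightarrow> 'a::real_normed_vector set \<Rightarrow> bool" where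
  "SQ_less \<kappa> X \<longleftrightarrow> subspace X \<and>
     (\<forall>Z. subspace Z \<and> Z \<subseteq> X \<and> dens Z <o \<kappa> \<longrightarrow>
       (\<exists>x \<in> X \<inter> sphere 0 1. \<forall>z\<in>Z. \<forall>c::real.
          norm (z + c *\<^sub>R x) \<le> max (norm z) \<bar>c\<bar>))"

lemma dens_attained:
  assumes "subspace Z"
  obtains A where "dense_span_in A Z" "dens Z = |A|"
    "\<And>B. dense_span_in B Z \<Longrightarrow> |A| \<le>o |B|"
proof -
  let ?R = "card_of ` {A. dense_span_in A Z}"
  have "dense_span_in Z Z"
    unfolding dense_span_in_def
    by (meson closure_subset order_refl order_trans span_superset)
  then have "?R \<noteq> {}" by blast
  moreover have "\<forall>r\<in>?R. Card_order r" by (auto simp: card_of_Card_order)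
  ultimately have "\<exists>r\<in>?R. \<forall>r'\<in>?R. r \<le>o r'"
    by (rule exists_minim_Card_order)
  then have ex: "\<exists>A. dense_span_in A Z \<and> (\<forall>B. dense_span_in B Z \<longrightarrow> |A| \<le>o |B| )" by auto
  show ?thesis
  proof (rule that)
    show "dens Z = |SOME A. dense_span_in A Z \<and> (\<forall>B. dense_span_in B Z \<longrightarrow> |A| \<le>o |B| )|"
      by (rule dens_def)
  qed (use someI_ex[OF ex] in simp_all)
qed

lemma dens_less_iff:
  assumes "subspace Z"
  shows "dens Z <o \<kappa> \<longleftrightarrow> (\<exists>A. dense_span_in A Z \<and> |A| <o \<kappa>)"
proof -
  obtain A where "dense_span_in A Z" "dens Z = |A|"
    "\<And>B. dense_span_in B Z \<Longrightarrow> |A| \<le>o |B|"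
    using dens_attained[OF assms] by blast
  then show ?thesis by (auto intro: ordLeq_ordLess_trans)
qed

end

theory Submission
  imports Defs
begin

text \<open>Since the density character of \<open>Z\<close> counts a set with dense span, adjoining one vector
  \<open>x\<close> to \<open>Z\<close> adds at most one generator, so it does not leave the densities below the infinite
  cardinal \<open>\<kappa>\<close> (\<open>dens_span_insert_less\<close>). If \<open>Z \<subseteq> Y\<close> is small, the whole space has a unit
  vector \<open>x\<close> that is square for \<open>Z\<close>, and the ideal property of \<open>Y\<close> applies to the still small
  space \<open>E\<close> spanned by \<open>Z\<close> and \<open>x\<close>. The resulting linear isometry \<open>T : E \<rightarrow> Y\<close> fixes \<open>Z\<close>, so
  \<open>\<parallel>z + c T x\<parallel> = \<parallel>T (z + c x)\<parallel> = \<parallel>z + c x\<parallel>\<close>: the vector \<open>T x\<close> lies in \<open>Y\<close> and is square for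
  \<open>Z\<close> with the same estimate.\<close>

lemma subspace_closure:
  fixes S :: "'a::real_normed_vector set"
  assumes "subspace S"
  shows "subspace (closure S)"
  unfolding subspace_def
proof (intro conjI ballI allI)
  show "0 \<in> closure S"
    using subspace_0[OF assms] closure_subset by blast
next
  fix u v assume "u \<in> closure S" "v \<in> closure S"
  then obtain f g where "\<forall>n. f n \<in> S" "f \<longlonglongrightarrow> u" "\<forall>n. g n \<in> S" "g \<longlonglongrightarrow> v"
    unfolding closure_sequential by blast
  then have "\<forall>n. f n + g n \<in> S" "(\<lambda>n. f n + g n) \<longlonglongrightarrow> u + v"
    using subspace_add[OF assms] by (auto intro: tendsto_add)
  then show "u + v \<in> closure S"
    unfolding closure_sequential by (intro exI[of _ "\<lambda>n. f n + g n"]) blast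
next
  fix c u assume "u \<in> closure S"
  then obtain f where "\<forall>n. f n \<in> S" "f \<longlonglongrightarrow> u"
    unfolding closure_sequential by blast
  then have "\<forall>n. c *\<^sub>R f n \<in> S" "(\<lambda>n. c *\<^sub>R f n) \<longlonglongrightarrow> c *\<^sub>R u"
    using subspace_scale[OF assms] by (auto intro: tendsto_scaleR)
  then show "c *\<^sub>R u \<in> closure S"
    unfolding closure_sequential by (intro exI[of _ "\<lambda>n. c *\<^sub>R f n"]) blast
qed

lemma dense_span_in_insert:
  assumes "dense_span_in A Z"
  shows "dense_span_in (insert x A) (span (insert x Z))"
proof -
  have "insert x A \<subseteq> span (insert x Z)"
    using assms span_superset[of "insert x Z"] unfolding dense_span_in_def by blast
  moreover have "insert x Z \<subseteq> closure (span (insert x A))"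
  proof -
    have "Z \<subseteq> closure (span A)" using assms by (simp add: dense_span_in_def)
    also have "\<dots> \<subseteq> closure (span (insert x A))"
      by (intro closure_mono span_mono) blast
    finally show ?thesis
      using closure_subset[of "span (insert x A)"] span_base[of x "insert x A"] by auto
  qed
  ultimately show ?thesis
    unfolding dense_span_in_def by (simp add: span_minimal subspace_closure)
qed

lemma card_of_insert_less_Cinfinite:
  assumes "Cinfinite \<kappa>" "|A| <o \<kappa>"
  shows "|insert x A| <o \<kappa>"
proof -
  have \<kappa>: "infinite (Field \<kappa>)" "Card_order \<kappa>"
    using assms(1) by (auto simp: cinfinite_def)
  have "|{x}| <o \<kappa>"
    using assms(1)
    by (intro Cfinite_ordLess_Cinfinite) (auto simp: cfinite_def card_of_card_order_on Field_card_of)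
  from card_of_Un_ordLess_infinite_Field[OF \<kappa> this assms(2)] show ?thesis by simp
qed

lemma dens_span_insert_less:
  assumes "Cinfinite \<kappa>" "subspace Z" "dens Z <o \<kappa>"
  shows "dens (span (insert x Z)) <o \<kappa>"
  using assms dense_span_in_insert card_of_insert_less_Cinfinite
  by (metis dens_less_iff subspace_span)

theorem proposition4p13:
  fixes \<kappa> :: "'k rel" and Y :: "'a::banach set"
  assumes "Cinfinite \<kappa>"
    and "SQ_less \<kappa> (UNIV :: 'a set)"
    and "isometric_ideal \<kappa> Y"
  shows "SQ_less \<kappa> Y"
  unfolding SQ_less_def
proof (intro conjI allI impI)
  show "subspace Y" using assms(3) by (simp add: isometric_ideal_def)
next
  fix Z assume "subspace Z \<and> Z \<subseteq> Y \<and> dens Z <o \<kappa>"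
  then have Z: "subspace Z" "Z \<subseteq> Y" "dens Z <o \<kappa>" by auto
  obtain x :: 'a where x: "norm x = 1"
    and sq: "\<And>z c. z \<in> Z \<Longrightarrow> norm (z + c *\<^sub>R x) \<le> max (norm z) \<bar>c\<bar>"
    using assms(2) Z unfolding SQ_less_def by fastforce
  define E where "E = span (insert x Z)"
  have "dens E <o \<kappa>"
    unfolding E_def using assms(1) Z by (intro dens_span_insert_less)
  then obtain T where T: "T \<in> E \<rightarrow> Y"
    and add: "\<And>u v. u \<in> E \<Longrightarrow> v \<in> E \<Longrightarrow> T (u + v) = T u + T v"
    and scale: "\<And>c u. u \<in> E \<Longrightarrow> T (c *\<^sub>R u) = c *\<^sub>R T u"
    and norm: "\<And>u. u \<in> E \<Longrightarrow> norm (T u) = norm u"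
    and fixed: "\<And>e. e \<in> E \<Longrightarrow> e \<in> Y \<Longrightarrow> T e = e"
    using assms(3) unfolding isometric_ideal_def by (metis E_def IntI subspace_span)
  have xE: "x \<in> E" and ZE: "Z \<subseteq> E"
    unfolding E_def using span_superset[of "insert x Z"] by auto
  have cE: "c *\<^sub>R x \<in> E" for c
    using xE by (simp add: E_def span_scale)
  show "\<exists>y\<in>Y \<inter> sphere 0 1. \<forall>z\<in>Z. \<forall>c::real. norm (z + c *\<^sub>R y) \<le> max (norm z) \<bar>c\<bar>"
  proof (intro bexI ballI allI)
    show "T x \<in> Y \<inter> sphere 0 1" using T xE norm x by auto
  next
    fix z c assume z: "z \<in> Z"
    then have zE: "z \<in> E" and "z \<in> Y" using ZE Z(2) by auto
    then have "z + c *\<^sub>R T x = T (z + c *\<^sub>R x)"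
      using add cE scale xE fixed by simp
    also have "norm \<dots> = norm (z + c *\<^sub>R x)"
      using zE cE by (intro norm) (simp add: E_def span_add)
    finally show "norm (z + c *\<^sub>R T x) \<le> max (norm z) \<bar>c\<bar>"
      using sq[OF z] by simp
  qed
qed

end
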